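(* Let $j,k \in \mathbb{N}$ and let $n \in \mathbb{O}_+$ have reduced Collatz sequence $$n\xrightarrow{a_1}C(n)\xrightarrow{a_2}\cdots\xrightarrow{a_j}1$$ of length $j$. Let $b \in \mathbb{N}_0$, set $a_{j+1}=a_{j+2}=\cdots=a_{j+k-1}=2$ and $a_{j+k} = 2b\cdot 3^{j+k-1} + 2$, and let $$m = \frac{2^{a_1+a_2+\cdots+a_j+2(k-1)}}{3^{j+k}}\left(2^{a_{j+k}}-2^2\right)+n.$$ Then $m$ is a positive odd integer with reduced Collatz sequence of length $j+k$ $$m \xrightarrow{a_1} C(m) \xrightarrow{a_2} \cdots \xrightarrow{a_j} C^j(m) \underbrace{\xrightarrow{2} C^{j+1}(m) \xrightarrow{2} \cdots \xrightarrow{2} C^{j+k-1}(m)}_{k-1\text{ times}} \xrightarrow{a_{j+k}} 1.$$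
   Context: $\mathbb{N}$ denotes the positive integers, $\mathbb{N}_0=\mathbb{N}\cup\{0\}$, and $\mathbb{O}_+$ the set of positive odd integers. The reduced Collatz function $C : \mathbb{O}_+ \to \mathbb{O}_+$ is $C(n) = \frac{3n+1}{2^a}$, where $a \in \mathbb{N}$ is the largest exponent such that $2^a \mid 3n+1$; $C^i$ is its $i$-th iterate. The notation $n \xrightarrow{a_1} C(n) \xrightarrow{a_2} \cdots \xrightarrow{a_j} C^j(n)$ means that for each $1\le i\le j$, $a_i$ is the largest exponent with $2^{a_i} \mid 3C^{i-1}(n)+1$, so that $C^i(n) = (3C^{i-1}(n)+1)/2^{a_i}$ (with $C^0(n)=n$). One says $n$ has reduced Collatz sequence length $j$ if $C^j(n)=1$; it is not required that $j$ be the first index at which $1$ is reached (so $1 \xrightarrow{2} 1$ may be repeated). *)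

theory Defs
  imports Complex_Main "HOL-Computational_Algebra.Primes"
begin

text \<open>Positive odd integers are odd natural numbers. The functions below are total on \<open>nat\<close>,
  but are only meaningful on odd arguments, a set that \<open>collatz\<close> preserves.\<close>

definition collatz_exponent :: "nat \<Rightarrow> nat" where
  "collatz_exponent n = multiplicity 2 (3 * n + 1)"

definition collatz :: "nat \<Rightarrow> nat" where
  "collatz n = (3 * n + 1) div 2 ^ collatz_exponent n"

lemma collatz_mult: "collatz n * 2 ^ collatz_exponent n = 3 * n + 1"
  unfolding collatz_def collatz_exponent_def
  by (rule dvd_div_mult_self) (rule multiplicity_dvd)

lemma odd_collatz: "odd (collatz n)"
  unfolding collatz_def collatz_exponent_def
  using multiplicity_decompose[of "3 * n + 1" "2::nat"] by simp

lemma collatz_exponent_pos: "odd n \<Longrightarrow> 0 < collatz_exponent n"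
  unfolding collatz_exponent_def
  by (subst multiplicity_gt_zero_iff) auto

text \<open>The sequence \<open>a\<close> is indexed from 1; only \<open>a 1, \<dots>, a j\<close> are constrained.\<close>

definition collatz_arrows :: "nat \<Rightarrow> (nat \<Rightarrow> nat) \<Rightarrow> nat \<Rightarrow> bool" where
  "collatz_arrows n a j \<longleftrightarrow> (\<forall>i\<in>{1..j}. a i = collatz_exponent ((collatz ^^ (i - 1)) n))"

text \<open>\<open>j\<close> need not be the first index at which 1 is reached.\<close>

definition reduced_collatz_length :: "nat \<Rightarrow> nat \<Rightarrow> bool" where
  "reduced_collatz_length n j \<longleftrightarrow> (collatz ^^ j) n = 1"

end

theory Submission
  imports Defs
begin

text \<open>Adding a multiple of \<open>2 ^ (a\<^sub>1 + \<dots> + a\<^sub>i + 1)\<close> to \<open>n\<close> does not change the first \<open>i\<close> exponents,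
  and moves the \<open>i\<close>-th iterate by \<open>2 * 3 ^ i\<close> times the factor. Put \<open>N = j + k - 1\<close>, so that
  \<open>C\<^sup>N(n) = 1\<close>. Since \<open>3 ^ (N + 1)\<close> divides \<open>4 ^ (b * 3 ^ N) - 1\<close>, with quotient \<open>q\<close> say,
  \<open>m = n + 2 ^ (a\<^sub>1 + \<dots> + a\<^sub>N + 1) * (2 * q)\<close>. Hence \<open>C\<^sup>N(m) = 1 + 4 * 3 ^ N * q\<close>, and
  \<open>3 * C\<^sup>N(m) + 1 = 4 * (1 + 3 ^ (N + 1) * q)\<close> is the power of two with exponent
  \<open>2 * b * 3 ^ N + 2\<close>.\<close>

lemma collatz_eqI:
  assumes "3 * n + 1 = 2 ^ e * c" and "odd c"
  shows "collatz_exponent n = e" and "collatz n = c"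
proof -
  show *: "collatz_exponent n = e"
    unfolding collatz_exponent_def
    by (rule multiplicity_eqI) (use assms in auto)
  show "collatz n = c"
    unfolding collatz_def * assms(1) by simp
qed

text \<open>Tripling the shift and dividing by \<open>2 ^ collatz_exponent n\<close> leaves the even
  number \<open>2 * (3 * v)\<close>, so the quotient stays odd and no further factor 2 splits off.
  The extra 2 from \<open>Suc\<close> is what guarantees this.\<close>

lemma collatz_add_multiple:
  fixes n v :: nat
  defines "x \<equiv> n + 2 ^ Suc (collatz_exponent n) * v"
  shows "collatz_exponent x = collatz_exponent n"
    and "collatz x = collatz n + 2 * (3 * v)"
proof -
  have "3 * x + 1 = 2 ^ collatz_exponent n * (collatz n + 2 * (3 * v))"
    using collatz_mult[of n] by (simp add: x_def algebra_simps)
  moreover have "odd (collatz n + 2 * (3 * v))"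
    using odd_collatz by simp
  ultimately show "collatz_exponent x = collatz_exponent n"
    and "collatz x = collatz n + 2 * (3 * v)"
    by (rule collatz_eqI)+
qed

definition exponent_sum :: "nat \<Rightarrow> nat \<Rightarrow> nat" where
  "exponent_sum n i = (\<Sum>l<i. collatz_exponent ((collatz ^^ l) n))"

lemma funpow_collatz_add_multiple:
  "(collatz ^^ i) (n + 2 ^ Suc (exponent_sum n i) * u) = (collatz ^^ i) n + 2 * (3 ^ i * u)"
proof (induction i arbitrary: u)
  case 0
  then show ?case by (simp add: exponent_sum_def)
next
  case (Suc i)
  let ?e = "collatz_exponent ((collatz ^^ i) n)"
  \<comment> \<open>The newest exponent moves into the factor, which is why \<open>u\<close> is
    arbitrary: the hypothesis for \<open>i\<close> steps then leaves exactly the power of two that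
    one further step consumes.\<close>
  have "n + 2 ^ Suc (exponent_sum n (Suc i)) * u = n + 2 ^ Suc (exponent_sum n i) * (2 ^ ?e * u)"
    by (simp add: exponent_sum_def power_add)
  then have "(collatz ^^ i) (n + 2 ^ Suc (exponent_sum n (Suc i)) * u)
      = (collatz ^^ i) n + 2 ^ Suc ?e * (3 ^ i * u)"
    by (simp only: Suc.IH) simp
  then show ?case
    using collatz_add_multiple(2)[of "(collatz ^^ i) n" "3 ^ i * u"] by simp
qed

text \<open>After only \<open>i\<close> steps the shift still carries the exponents of all later
  steps. As \<open>i < N\<close>, these include the current one, so one more step applies;
  \<open>r\<close> collects the rest.\<close>

lemma collatz_exponent_funpow_add_multiple:
  assumes "i < N"
  shows "collatz_exponent ((collatz ^^ i) (n + 2 ^ Suc (exponent_sum n N) * u))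
    = collatz_exponent ((collatz ^^ i) n)"
proof -
  let ?e = "collatz_exponent ((collatz ^^ i) n)"
  have "exponent_sum n (Suc i) \<le> exponent_sum n N"
    unfolding exponent_sum_def by (rule sum_mono2) (use assms in auto)
  then obtain r where "exponent_sum n N = exponent_sum n i + ?e + r"
    by (auto simp: exponent_sum_def le_iff_add)
  then have "n + 2 ^ Suc (exponent_sum n N) * u
      = n + 2 ^ Suc (exponent_sum n i) * (2 ^ ?e * (2 ^ r * u))"
    by (simp add: power_add)
  then have "(collatz ^^ i) (n + 2 ^ Suc (exponent_sum n N) * u)
      = (collatz ^^ i) n + 2 ^ Suc ?e * (3 ^ i * (2 ^ r * u))"
    by (simp only: funpow_collatz_add_multiple) simp
  then show ?thesis
    by (simp only: collatz_add_multiple(1))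
qed

lemma collatz_1: "collatz_exponent 1 = 2" "collatz 1 = 1"
  using collatz_eqI[of 1 2 1] by simp_all

lemma funpow_collatz_eq_1_mono:
  assumes "(collatz ^^ j) n = 1" and "j \<le> i"
  shows "(collatz ^^ i) n = 1"
  using assms(2) by (induction i rule: dec_induct) (use assms(1) collatz_1 in auto)

text \<open>Passing from \<open>N\<close> to \<open>Suc N\<close> cubes \<open>x\<close>, and
  \<open>x ^ 3 - 1\<close> is \<open>x - 1\<close> times a factor that gains one more 3, because
  \<open>x\<close> is 1 modulo 3.\<close>

lemma pow3_dvd_pow4_minus_1: "(3::int) ^ Suc N dvd 4 ^ (b * 3 ^ N) - 1"
proof (induction N)
  case 0
  have "(4::int) ^ b mod 3 = 1"
    using power_mod[of "4::int" 3 b] by simp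
  then show ?case by (simp add: mod_eq_dvd_iff[symmetric])
next
  case (Suc N)
  define x :: int where "x = 4 ^ (b * 3 ^ N)"
  have "3 dvd x - 1"
    using Suc dvd_trans[of 3 "3 ^ Suc N" "x - 1"] by (simp add: x_def)
  then have "3 dvd (x - 1) * (x + 2) + 3" by simp
  then have "3 dvd x\<^sup>2 + x + 1" by (simp add: algebra_simps power2_eq_square)
  with Suc have "3 ^ Suc N * 3 dvd (x - 1) * (x\<^sup>2 + x + 1)"
    unfolding x_def[symmetric] by (rule mult_dvd_mono)
  moreover have "(x - 1) * (x\<^sup>2 + x + 1) = x ^ 3 - 1"
    by (simp add: algebra_simps power2_eq_square power3_eq_cube)
  moreover have "x ^ 3 = 4 ^ (b * 3 ^ Suc N)"
    by (simp add: x_def power_mult[symmetric] mult_ac)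
  ultimately show ?case by (simp add: mult_ac)
qed

lemma pow4_eq_1_plus_pow3_mult:
  obtains q :: nat where "4 ^ (b * 3 ^ N) = 1 + 3 ^ Suc N * q"
proof -
  have "int (3 ^ Suc N) dvd int (4 ^ (b * 3 ^ N) - 1)"
    using pow3_dvd_pow4_minus_1[of N b] by (simp add: of_nat_diff)
  then have "3 ^ Suc N dvd 4 ^ (b * 3 ^ N) - (1::nat)"
    by (simp only: of_nat_dvd_iff)
  then obtain q where "4 ^ (b * 3 ^ N) - (1::nat) = 3 ^ Suc N * q" ..
  then have "4 ^ (b * 3 ^ N) = 1 + 3 ^ Suc N * q"
    by (metis le_add_diff_inverse one_le_numeral one_le_power)
  then show ?thesis by (rule that)
qed

theorem corollary3p2:
  fixes j k n b :: nat and a :: "nat \<Rightarrow> nat" and m :: rat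
  assumes "j \<ge> 1" and "k \<ge> 1" and "odd n"
    and "collatz_arrows n a j" and "reduced_collatz_length n j"
    and "\<And>i. j < i \<Longrightarrow> i < j + k \<Longrightarrow> a i = 2"
    and "a (j + k) = 2 * b * 3 ^ (j + k - 1) + 2"
    and "m = 2 ^ ((\<Sum>i=1..j. a i) + 2 * (k - 1)) / 3 ^ (j + k) * (2 ^ a (j + k) - 2 ^ 2) + of_nat n"
  shows "\<exists>M::nat. m = of_nat M \<and> M > 0 \<and> odd M
    \<and> collatz_arrows M a (j + k) \<and> reduced_collatz_length M (j + k)"
proof -
  define N where "N = j + k - 1"
  have jk: "j + k = Suc N" and N: "N = j + (k - 1)" using assms(2) by (auto simp: N_def)
  have reach: "(collatz ^^ i) n = 1" if "j \<le> i" for i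
    using assms(5) that funpow_collatz_eq_1_mono unfolding reduced_collatz_length_def by blast
  have exponents: "a (Suc l) = collatz_exponent ((collatz ^^ l) n)" if "l < N" for l
  proof (cases "l < j")
    case True
    then show ?thesis using assms(4) by (auto simp: collatz_arrows_def dest: bspec[of _ _ "Suc l"])
  next
    case False
    \<comment> \<open>From index \<open>j\<close> on the orbit of \<open>n\<close> rests at 1, whose
      exponent 2 is the prescribed value.\<close>
    then show ?thesis using assms(6)[of "Suc l"] that reach[of l] collatz_1(1) jk by simp
  qed
  have "exponent_sum n N = (\<Sum>l<N. a (Suc l))"
    unfolding exponent_sum_def by (rule sum.cong) (auto simp: exponents)
  also have "\<dots> = (\<Sum>i=1..N. a i)"
    using sum.atLeast1_atMost_eq[of a N] by simp
  also have "\<dots> = (\<Sum>i=1..j. a i) + (\<Sum>i=j+1..j+(k-1). a i)"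
    unfolding N by (rule sum.ub_add_nat) simp
  also have "(\<Sum>i=j+1..j+(k-1). a i) = (\<Sum>i=j+1..j+(k-1). 2)"
    by (rule sum.cong) (use assms(2,6) in auto)
  also have "\<dots> = 2 * (k - 1)" by simp
  finally have sum_eq: "(\<Sum>i=1..j. a i) + 2 * (k - 1) = exponent_sum n N" ..
  obtain q :: nat where q: "4 ^ (b * 3 ^ N) = 1 + 3 ^ Suc N * q"
    by (rule pow4_eq_1_plus_pow3_mult)
  \<comment> \<open>The quotient \<open>q\<close> cancels the denominator:
    \<open>2 ^ a (Suc N) - 4\<close> equals \<open>4 * 3 ^ Suc N * q\<close>. One factor 2 of this 4
    supplies the \<open>Suc\<close>, the other stays with \<open>q\<close>.\<close>
  define M where "M = n + 2 ^ Suc (exponent_sum n N) * (2 * q)"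
  have aN: "a (Suc N) = 2 * (b * 3 ^ N) + 2"
    using assms(7) unfolding jk by simp
  have pow_a: "2 ^ a (Suc N) = 4 * (1 + 3 ^ Suc N * q)"
    unfolding aN power_add power_mult[of 2 2] using q by simp
  then have "(2::rat) ^ a (Suc N) = of_nat (4 * (1 + 3 ^ Suc N * q))"
    by (metis of_nat_numeral of_nat_power)
  then have "m = of_nat M"
    unfolding assms(8) jk sum_eq M_def by (simp add: field_simps)
  moreover have "odd M" using assms(3) by (simp add: M_def)
  moreover from this have "M > 0" by (rule odd_pos)
  \<comment> \<open>With odd cofactor 1, this gives both the last exponent and the final value
    1.\<close>
  moreover have "3 * (collatz ^^ N) M + 1 = 2 ^ a (Suc N) * 1"
    unfolding M_def funpow_collatz_add_multiple pow_a using reach[of N] N by simp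
  note last = collatz_eqI[OF this odd_one]
  have "a (Suc l) = collatz_exponent ((collatz ^^ l) M)" if "l < Suc N" for l
  proof (cases "l = N")
    case True
    then show ?thesis by (simp add: last(1))
  next
    case False
    with that have "l < N" by simp
    then show ?thesis
      by (simp only: M_def collatz_exponent_funpow_add_multiple exponents)
  qed
  then have "collatz_arrows M a (j + k)"
    unfolding collatz_arrows_def jk by (auto simp: Suc_le_eq gr0_conv_Suc)
  moreover have "reduced_collatz_length M (j + k)"
    using last(2) by (simp add: reduced_collatz_length_def jk)
  ultimately show ?thesis by blast
qed

end
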